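(* Let $\vec{x}=(x_0,\dots,x_{n-1})$, $\vec{y}=(y_0,\dots,y_{n-1})$ and $\vec{z}=(z_0,\dots,z_{l-1})$ be tuples of variables. Then $$\Big(\bigwedge_{I\subseteq n}\{x_i \mid i\notin I\}\perp_{\{x_i \mid i\in I\}\vec{z}}\{y_i \mid i\in I\}\Big)\wedge =\!(\vec{x}\vec{z},\vec{y})\ \vdash\ \bigwedge_{i<n}=\!(x_i\vec{z},y_i),$$ where $n$ is identified with $\{0,\dots,n-1\}$ and $\vdash$ is derivability by the rules listed in the context.
   Context: Syntax. Variables have sorts in $\mathbb{N}$. A vocabulary $\tau$ consists of a set $S_\tau\subseteq\mathbb{N}$ of sorts and sorted relation symbols. Formulas of independence logic are built from literals ($u=v$, $R(\vec{x})$ and their negations) and independence atoms $\vec{y}\perp_{\vec{x}}\vec{z}$ (finite, possibly empty, tuples of variables) by $\wedge,\vee,\exists,\forall$ and the new-sort quantifiers $\tilde\exists v,\tilde\forall v$, where $\tilde\exists v\varphi$, $\tilde\forall v\varphi$ are $\tau$-formulas when $\mathrm{sort}(v)\notin S_\tau$ and $\varphi$ is a formula of $\tau$ enlarged by the sort $\mathrm{sort}(v)$ in which no variable of that sort other than $v$ is free. $=\!(\vec{x},\vec{y})$ abbreviates $\vec{y}\perp_{\vec{x}}\vec{y}$. Dependence logic is the fragment in which only independence atoms of the form $\vec{y}\perp_{\vec{x}}\vec{y}$ occur. Juxtaposition of tuples is concatenation, and a finite set of indexed variables inside an atom is read as a tuple listing it. Rules. $\Sigma\vdash\psi$ is the least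 relation (between sets of formulas and formulas of a common vocabulary), closed under the usual structural rules (assumption, weakening, cut), given by: (I) Independence atom: Constancy: $\vec{y}\perp_{\vec{x}}\vec{y}$ entails $\vec{y}\perp_{\vec{x}}\vec{z}$. Reflexivity: $\vec{x}\perp_{\vec{x}}\vec{y}$. Symmetry: $\vec{z}\perp_{\vec{x}}\vec{y}$ entails $\vec{y}\perp_{\vec{x}}\vec{z}$. Weakening: $\vec{y}y'\perp_{\vec{x}}\vec{z}z'$ entails $\vec{y}\perp_{\vec{x}}\vec{z}$. Permutation: each of the three tuples may be permuted. Fixed Parameter: $\vec{z}\perp_{\vec{x}}\vec{y}$ entails $\vec{y}\vec{x}\perp_{\vec{x}}\vec{z}\vec{x}$. First Transitivity: $\vec{x}\perp_{\vec{z}}\vec{y}\wedge\vec{u}\perp_{\vec{z}\vec{x}}\vec{y}$ entails $\vec{u}\perp_{\vec{z}}\vec{y}$. Second Transitivity: $\vec{y}\perp_{\vec{z}}\vec{y}\wedge\vec{z}\vec{x}\perp_{\vec{y}}\vec{u}$ entails $\vec{x}\perp_{\vec{z}}\vec{u}$. Exchange: $\vec{x}\perp_{\vec{z}}\vec{y}\wedge\vec{x}\vec{y}\perp_{\vec{z}}\vec{u}$ entails $\vec{x}\perp_{\vec{z}}\vec{y}\vec{u}$. (II) Dependence atom: $=\!(\vec{x}\vec{y},\vec{x})$; $=\!(\vec{x},\vec{y})\wedge=\!(\vec{y},\vec{z})$ entails $=\!(\vec{x},\vec{z})$; $=\!(\vec{x},\vec{y})$ entails $=\!(\vec{x},\vec{x}\vec{y})$;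 both tuples may be permuted. (III) Semigraphoid axioms: $\vec{x}\perp_{\vec{z}}\emptyset$; Symmetry; $\vec{x}\perp_{\vec{z}}\vec{y}\vec{w}$ entails $\vec{x}\perp_{\vec{z}}\vec{y}$ (Decomposition) and entails $\vec{x}\perp_{\vec{z}\vec{w}}\vec{y}$ (Weak Union); $\vec{x}\perp_{\vec{z}}\vec{y}\wedge\vec{x}\perp_{\vec{z}\vec{y}}\vec{w}$ entails $\vec{x}\perp_{\vec{z}}\vec{y}\vec{w}$ (Contraction); Permutation; $\vec{x}\perp_{\vec{z}}\vec{y}$ entails $\vec{x}\vec{x}\perp_{\vec{z}\vec{z}}\vec{y}\vec{y}$ (Repetition). (IV) Logical rules: ($\exists$-elimination) if $\Sigma\cup\{\varphi\}\vdash\psi$ and $x$ is not free in $\psi$ or in any member of $\Sigma$, then $\Sigma\cup\{\exists x\varphi\}\vdash\psi$. ($\exists$-introduction) if $y$ has the same sort as $x$ and no free occurrence of $x$ in $\varphi$ lies in the scope of a quantifier $Qy$, then $\varphi(y/x)$ entails $\exists x\varphi$. ($\wedge$) $\varphi\wedge\psi$ entails $\varphi$ and $\psi$; $\{\varphi,\psi\}$ entails $\varphi\wedge\psi$. (Dependence introduction) $\exists x\varphi$ entails $\exists x(=\!(\vec{z},x)\wedge\varphi)$ whenever $\varphi$ is a formula of dependence logic and $\vec{z}$ lists the free variables of $\exists x\varphi$. (First $\tilde\exists$-introduction) if no variable of sort $\mathrm{sort}(x)$ occurs in any formula of $\Sigma$ and $\Sigma\vdash\exists x\varphi$, then $\Sigma\vdash\tilde\exists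 x\varphi$. (Second $\tilde\exists$-introduction) if no variable of sort $\mathrm{sort}(x)$ occurs in any formula of $\Sigma$ and $\Sigma\cup\{\exists x\varphi\}\vdash\exists y\psi$, where $\mathrm{sort}(y)=\mathrm{sort}(x)$, then $\Sigma\cup\{\tilde\exists x\varphi\}\vdash\tilde\exists y\psi$. *)

theory Defs
  imports Main "HOL-Library.Multiset"
begin

datatype var = Var (vsort: nat) (vindex: nat)

text \<open>A vocabulary fixes the relation symbols that are present, each with the list of sorts
  of its argument places. These sorts have to belong to the vocabulary.\<close>

record 'r vocabulary =
  sorts :: "nat set"
  rel_sorts :: "'r \<rightharpoonup> nat list"

definition vocabulary :: "'r vocabulary \<Rightarrow> bool" where
  "vocabulary \<tau> \<longleftrightarrow> (\<forall>ss \<in> ran (rel_sorts \<tau>). set ss \<subseteq> sorts \<tau>)"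

definition enlarge :: "'r vocabulary \<Rightarrow> nat \<Rightarrow> 'r vocabulary" where
  "enlarge \<tau> s = \<tau>\<lparr>sorts := insert s (sorts \<tau>)\<rparr>"

text \<open>\<open>NewExists\<close> and \<open>NewForall\<close> are the new-sort quantifiers. In an independence atom the
  parameter tuple is the second argument.\<close>

datatype 'r formula =
    Eq var var
  | Neq var var
  | Rel 'r "var list"
  | NotRel 'r "var list"
  | Indep "var list" "var list" "var list"  ("_ \<bottom>\<^bsub>_\<^esub> _" [61, 0, 61] 60)
  | And "'r formula" "'r formula"
  | Or "'r formula" "'r formula"
  | Exists var "'r formula"
  | Forall var "'r formula"
  | NewExists var "'r formula"
  | NewForall var "'r formula"

abbreviation Dep :: "var list \<Rightarrow> var list \<Rightarrow> 'r formula" where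
  "Dep xs ys \<equiv> ys \<bottom>\<^bsub>xs\<^esub> ys"

text \<open>The language has no propositional constant for truth. The empty conjunction is the
  independence atom between empty tuples, an instance of Reflexivity.\<close>

fun Conj :: "'r formula list \<Rightarrow> 'r formula" where
  "Conj [] = [] \<bottom>\<^bsub>[]\<^esub> []"
| "Conj [\<phi>] = \<phi>"
| "Conj (\<phi> # \<psi> # \<phi>s) = And \<phi> (Conj (\<psi> # \<phi>s))"

fun free_vars :: "'r formula \<Rightarrow> var set" where
  "free_vars (Eq u v) = {u, v}"
| "free_vars (Neq u v) = {u, v}"
| "free_vars (Rel R us) = set us"
| "free_vars (NotRel R us) = set us"
| "free_vars (ys \<bottom>\<^bsub>xs\<^esub> zs) = set ys \<union> set xs \<union> set zs"
| "free_vars (And \<phi> \<psi>) = free_vars \<phi> \<union> free_vars \<psi>"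
| "free_vars (Or \<phi> \<psi>) = free_vars \<phi> \<union> free_vars \<psi>"
| "free_vars (Exists v \<phi>) = free_vars \<phi> - {v}"
| "free_vars (Forall v \<phi>) = free_vars \<phi> - {v}"
| "free_vars (NewExists v \<phi>) = free_vars \<phi> - {v}"
| "free_vars (NewForall v \<phi>) = free_vars \<phi> - {v}"

text \<open>All variables that occur, whether free, bound or attached to a quantifier.\<close>

fun occurring_vars :: "'r formula \<Rightarrow> var set" where
  "occurring_vars (Eq u v) = {u, v}"
| "occurring_vars (Neq u v) = {u, v}"
| "occurring_vars (Rel R us) = set us"
| "occurring_vars (NotRel R us) = set us"
| "occurring_vars (ys \<bottom>\<^bsub>xs\<^esub> zs) = set ys \<union> set xs \<union> set zs"
| "occurring_vars (And \<phi> \<psi>) = occurring_vars \<phi> \<union> occurring_vars \<psi>"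
| "occurring_vars (Or \<phi> \<psi>) = occurring_vars \<phi> \<union> occurring_vars \<psi>"
| "occurring_vars (Exists v \<phi>) = insert v (occurring_vars \<phi>)"
| "occurring_vars (Forall v \<phi>) = insert v (occurring_vars \<phi>)"
| "occurring_vars (NewExists v \<phi>) = insert v (occurring_vars \<phi>)"
| "occurring_vars (NewForall v \<phi>) = insert v (occurring_vars \<phi>)"

fun wff :: "'r vocabulary \<Rightarrow> 'r formula \<Rightarrow> bool" where
  "wff \<tau> (Eq u v) \<longleftrightarrow> vsort u \<in> sorts \<tau> \<and> vsort v \<in> sorts \<tau>"
| "wff \<tau> (Neq u v) \<longleftrightarrow> vsort u \<in> sorts \<tau> \<and> vsort v \<in> sorts \<tau>"
| "wff \<tau> (Rel R us) \<longleftrightarrow> rel_sorts \<tau> R = Some (map vsort us)"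
| "wff \<tau> (NotRel R us) \<longleftrightarrow> rel_sorts \<tau> R = Some (map vsort us)"
| "wff \<tau> (ys \<bottom>\<^bsub>xs\<^esub> zs) \<longleftrightarrow> vsort ` (set ys \<union> set xs \<union> set zs) \<subseteq> sorts \<tau>"
| "wff \<tau> (And \<phi> \<psi>) \<longleftrightarrow> wff \<tau> \<phi> \<and> wff \<tau> \<psi>"
| "wff \<tau> (Or \<phi> \<psi>) \<longleftrightarrow> wff \<tau> \<phi> \<and> wff \<tau> \<psi>"
| "wff \<tau> (Exists v \<phi>) \<longleftrightarrow> vsort v \<in> sorts \<tau> \<and> wff \<tau> \<phi>"
| "wff \<tau> (Forall v \<phi>) \<longleftrightarrow> vsort v \<in> sorts \<tau> \<and> wff \<tau> \<phi>"
| "wff \<tau> (NewExists v \<phi>) \<longleftrightarrow> vsort v \<notin> sorts \<tau> \<and> wff (enlarge \<tau> (vsort v)) \<phi> \<and>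
     (\<forall>u \<in> free_vars \<phi>. vsort u = vsort v \<longrightarrow> u = v)"
| "wff \<tau> (NewForall v \<phi>) \<longleftrightarrow> vsort v \<notin> sorts \<tau> \<and> wff (enlarge \<tau> (vsort v)) \<phi> \<and>
     (\<forall>u \<in> free_vars \<phi>. vsort u = vsort v \<longrightarrow> u = v)"

definition common_vocabulary :: "'r formula set \<Rightarrow> bool" where
  "common_vocabulary \<Gamma> \<longleftrightarrow> (\<exists>\<tau>. vocabulary \<tau> \<and> (\<forall>\<phi> \<in> \<Gamma>. wff \<tau> \<phi>))"

fun dependence_formula :: "'r formula \<Rightarrow> bool" where
  "dependence_formula (Eq u v) \<longleftrightarrow> True"
| "dependence_formula (Neq u v) \<longleftrightarrow> True"
| "dependence_formula (Rel R us) \<longleftrightarrow> True"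
| "dependence_formula (NotRel R us) \<longleftrightarrow> True"
| "dependence_formula (ys \<bottom>\<^bsub>xs\<^esub> zs) \<longleftrightarrow> ys = zs"
| "dependence_formula (And \<phi> \<psi>) \<longleftrightarrow> dependence_formula \<phi> \<and> dependence_formula \<psi>"
| "dependence_formula (Or \<phi> \<psi>) \<longleftrightarrow> dependence_formula \<phi> \<and> dependence_formula \<psi>"
| "dependence_formula (Exists v \<phi>) \<longleftrightarrow> dependence_formula \<phi>"
| "dependence_formula (Forall v \<phi>) \<longleftrightarrow> dependence_formula \<phi>"
| "dependence_formula (NewExists v \<phi>) \<longleftrightarrow> dependence_formula \<phi>"
| "dependence_formula (NewForall v \<phi>) \<longleftrightarrow> dependence_formula \<phi>"

definition rename_var :: "var \<Rightarrow> var \<Rightarrow> var \<Rightarrow> var" where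
  "rename_var x y u = (if u = x then y else u)"

text \<open>\<open>subst x y \<phi>\<close> replaces the free occurrences of \<open>x\<close> by \<open>y\<close>.\<close>

fun subst :: "var \<Rightarrow> var \<Rightarrow> 'r formula \<Rightarrow> 'r formula" where
  "subst x y (Eq u v) = Eq (rename_var x y u) (rename_var x y v)"
| "subst x y (Neq u v) = Neq (rename_var x y u) (rename_var x y v)"
| "subst x y (Rel R us) = Rel R (map (rename_var x y) us)"
| "subst x y (NotRel R us) = NotRel R (map (rename_var x y) us)"
| "subst x y (us \<bottom>\<^bsub>vs\<^esub> ws) =
     map (rename_var x y) us \<bottom>\<^bsub>map (rename_var x y) vs\<^esub> map (rename_var x y) ws"
| "subst x y (And \<phi> \<psi>) = And (subst x y \<phi>) (subst x y \<psi>)"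
| "subst x y (Or \<phi> \<psi>) = Or (subst x y \<phi>) (subst x y \<psi>)"
| "subst x y (Exists v \<phi>) = Exists v (if v = x then \<phi> else subst x y \<phi>)"
| "subst x y (Forall v \<phi>) = Forall v (if v = x then \<phi> else subst x y \<phi>)"
| "subst x y (NewExists v \<phi>) = NewExists v (if v = x then \<phi> else subst x y \<phi>)"
| "subst x y (NewForall v \<phi>) = NewForall v (if v = x then \<phi> else subst x y \<phi>)"

text \<open>\<open>free_for x y \<phi>\<close>: no free occurrence of \<open>x\<close> in \<open>\<phi>\<close> lies in the scope of a quantifier
  binding \<open>y\<close>.\<close>

fun free_for :: "var \<Rightarrow> var \<Rightarrow> 'r formula \<Rightarrow> bool" where
  "free_for x y (Eq u v) \<longleftrightarrow> True"
| "free_for x y (Neq u v) \<longleftrightarrow> True"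
| "free_for x y (Rel R us) \<longleftrightarrow> True"
| "free_for x y (NotRel R us) \<longleftrightarrow> True"
| "free_for x y (us \<bottom>\<^bsub>vs\<^esub> ws) \<longleftrightarrow> True"
| "free_for x y (And \<phi> \<psi>) \<longleftrightarrow> free_for x y \<phi> \<and> free_for x y \<psi>"
| "free_for x y (Or \<phi> \<psi>) \<longleftrightarrow> free_for x y \<phi> \<and> free_for x y \<psi>"
| "free_for x y (Exists v \<phi>) \<longleftrightarrow> x \<notin> free_vars (Exists v \<phi>) \<or> (v \<noteq> y \<and> free_for x y \<phi>)"
| "free_for x y (Forall v \<phi>) \<longleftrightarrow> x \<notin> free_vars (Forall v \<phi>) \<or> (v \<noteq> y \<and> free_for x y \<phi>)"
| "free_for x y (NewExists v \<phi>) \<longleftrightarrow> x \<notin> free_vars (NewExists v \<phi>) \<or> (v \<noteq> y \<and> free_for x y \<phi>)"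
| "free_for x y (NewForall v \<phi>) \<longleftrightarrow> x \<notin> free_vars (NewForall v \<phi>) \<or> (v \<noteq> y \<and> free_for x y \<phi>)"

definition sort_absent :: "nat \<Rightarrow> 'r formula set \<Rightarrow> bool" where
  "sort_absent s \<Sigma> \<longleftrightarrow> (\<forall>\<phi> \<in> \<Sigma>. \<forall>u \<in> occurring_vars \<phi>. vsort u \<noteq> s)"

text \<open>Derivability relates sets of formulas and formulas of a common vocabulary. Where this is
  not automatic, a rule has a side condition \<open>common_vocabulary\<close> on its conclusion; it is
  automatic for rules between independence atoms, which contain no relation symbols. In
  \<open>indep_weakening\<close> one variable is dropped on each side. Symmetry and Permutation are shared
  by the independence atom rules and the semigraphoid axioms.\<close>

inductive derives :: "'r formula set \<Rightarrow> 'r formula \<Rightarrow> bool"  (infix "\<turnstile>" 45) where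
  assumption:
    "\<phi> \<in> \<Sigma> \<Longrightarrow> common_vocabulary \<Sigma> \<Longrightarrow> \<Sigma> \<turnstile> \<phi>"
| weakening:
    "\<Sigma> \<turnstile> \<psi> \<Longrightarrow> \<Sigma> \<subseteq> \<Sigma>' \<Longrightarrow> common_vocabulary (\<Sigma>' \<union> {\<psi>}) \<Longrightarrow> \<Sigma>' \<turnstile> \<psi>"
| cut:
    "\<Sigma> \<turnstile> \<phi> \<Longrightarrow> \<Sigma> \<union> {\<phi>} \<turnstile> \<psi> \<Longrightarrow> \<Sigma> \<turnstile> \<psi>"

| indep_constancy:
    "{ys \<bottom>\<^bsub>xs\<^esub> ys} \<turnstile> ys \<bottom>\<^bsub>xs\<^esub> zs"
| indep_reflexivity:
    "{} \<turnstile> xs \<bottom>\<^bsub>xs\<^esub> ys"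
| indep_symmetry:
    "{zs \<bottom>\<^bsub>xs\<^esub> ys} \<turnstile> ys \<bottom>\<^bsub>xs\<^esub> zs"
| indep_weakening:
    "{ys @ [y'] \<bottom>\<^bsub>xs\<^esub> zs @ [z']} \<turnstile> ys \<bottom>\<^bsub>xs\<^esub> zs"
| indep_permutation:
    "mset ys' = mset ys \<Longrightarrow> mset xs' = mset xs \<Longrightarrow> mset zs' = mset zs \<Longrightarrow>
     {ys \<bottom>\<^bsub>xs\<^esub> zs} \<turnstile> ys' \<bottom>\<^bsub>xs'\<^esub> zs'"
| indep_fixed_parameter:
    "{zs \<bottom>\<^bsub>xs\<^esub> ys} \<turnstile> ys @ xs \<bottom>\<^bsub>xs\<^esub> zs @ xs"
| indep_first_transitivity:
    "{And (xs \<bottom>\<^bsub>zs\<^esub> ys) (us \<bottom>\<^bsub>zs @ xs\<^esub> ys)} \<turnstile> us \<bottom>\<^bsub>zs\<^esub> ys"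
| indep_second_transitivity:
    "{And (ys \<bottom>\<^bsub>zs\<^esub> ys) (zs @ xs \<bottom>\<^bsub>ys\<^esub> us)} \<turnstile> xs \<bottom>\<^bsub>zs\<^esub> us"
| indep_exchange:
    "{And (xs \<bottom>\<^bsub>zs\<^esub> ys) (xs @ ys \<bottom>\<^bsub>zs\<^esub> us)} \<turnstile> xs \<bottom>\<^bsub>zs\<^esub> ys @ us"

| dep_reflexivity:
    "{} \<turnstile> Dep (xs @ ys) xs"
| dep_transitivity:
    "{And (Dep xs ys) (Dep ys zs)} \<turnstile> Dep xs zs"
| dep_extension:
    "{Dep xs ys} \<turnstile> Dep xs (xs @ ys)"
| dep_permutation:
    "mset xs' = mset xs \<Longrightarrow> mset ys' = mset ys \<Longrightarrow> {Dep xs ys} \<turnstile> Dep xs' ys'"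

| semigraphoid_triviality:
    "{} \<turnstile> xs \<bottom>\<^bsub>zs\<^esub> []"
| semigraphoid_decomposition:
    "{xs \<bottom>\<^bsub>zs\<^esub> ys @ ws} \<turnstile> xs \<bottom>\<^bsub>zs\<^esub> ys"
| semigraphoid_weak_union:
    "{xs \<bottom>\<^bsub>zs\<^esub> ys @ ws} \<turnstile> xs \<bottom>\<^bsub>zs @ ws\<^esub> ys"
| semigraphoid_contraction:
    "{And (xs \<bottom>\<^bsub>zs\<^esub> ys) (xs \<bottom>\<^bsub>zs @ ys\<^esub> ws)} \<turnstile> xs \<bottom>\<^bsub>zs\<^esub> ys @ ws"
| semigraphoid_repetition:
    "{xs \<bottom>\<^bsub>zs\<^esub> ys} \<turnstile> xs @ xs \<bottom>\<^bsub>zs @ zs\<^esub> ys @ ys"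

| exists_elimination:
    "\<Sigma> \<union> {\<phi>} \<turnstile> \<psi> \<Longrightarrow> x \<notin> free_vars \<psi> \<Longrightarrow> (\<forall>\<chi> \<in> \<Sigma>. x \<notin> free_vars \<chi>) \<Longrightarrow>
     common_vocabulary (\<Sigma> \<union> {Exists x \<phi>, \<psi>}) \<Longrightarrow>
     \<Sigma> \<union> {Exists x \<phi>} \<turnstile> \<psi>"
| exists_introduction:
    "vsort y = vsort x \<Longrightarrow> free_for x y \<phi> \<Longrightarrow>
     common_vocabulary {subst x y \<phi>, Exists x \<phi>} \<Longrightarrow>
     {subst x y \<phi>} \<turnstile> Exists x \<phi>"
| conj_elimination1:
    "common_vocabulary {And \<phi> \<psi>} \<Longrightarrow> {And \<phi> \<psi>} \<turnstile> \<phi>"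
| conj_elimination2:
    "common_vocabulary {And \<phi> \<psi>} \<Longrightarrow> {And \<phi> \<psi>} \<turnstile> \<psi>"
| conj_introduction:
    "common_vocabulary {\<phi>, \<psi>} \<Longrightarrow> {\<phi>, \<psi>} \<turnstile> And \<phi> \<psi>"
| dependence_introduction:
    "dependence_formula \<phi> \<Longrightarrow> distinct zs \<Longrightarrow> set zs = free_vars (Exists x \<phi>) \<Longrightarrow>
     common_vocabulary {Exists x \<phi>} \<Longrightarrow>
     {Exists x \<phi>} \<turnstile> Exists x (And (Dep zs [x]) \<phi>)"
| new_exists_introduction1:
    "\<Sigma> \<turnstile> Exists x \<phi> \<Longrightarrow> sort_absent (vsort x) \<Sigma> \<Longrightarrow>
     common_vocabulary (\<Sigma> \<union> {NewExists x \<phi>}) \<Longrightarrow>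
     \<Sigma> \<turnstile> NewExists x \<phi>"
| new_exists_introduction2:
    "\<Sigma> \<union> {Exists x \<phi>} \<turnstile> Exists y \<psi> \<Longrightarrow> sort_absent (vsort x) \<Sigma> \<Longrightarrow> vsort y = vsort x \<Longrightarrow>
     common_vocabulary (\<Sigma> \<union> {NewExists x \<phi>, NewExists y \<psi>}) \<Longrightarrow>
     \<Sigma> \<union> {NewExists x \<phi>} \<turnstile> NewExists y \<psi>"

end

theory Submission
  imports Defs
begin

text \<open>Only the singletons \<open>I = {i}\<close> matter: \<open>=(xs zs, ys)\<close> yields \<open>=(xs zs, y\<^sub>i)\<close>, and First
  Transitivity removes the remaining \<open>xs\<close> from the parameter because they are independent of
  \<open>y\<^sub>i\<close> over \<open>x\<^sub>i zs\<close>.\<close>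

lemma common_vocabularyI:
  assumes "vocabulary \<tau>" and "\<And>\<phi>. \<phi> \<in> \<Gamma> \<Longrightarrow> wff \<tau> \<phi>"
  shows "common_vocabulary \<Gamma>"
  using assms unfolding common_vocabulary_def by blast

text \<open>Most rules have their premise as the only assumption, while \<open>cut\<close> keeps one
  fixed set. Weakening the second derivation to \<open>\<Sigma>\<close> joined with
  \<open>\<phi>\<close> makes such rules composable.\<close>

lemma derives_trans:
  assumes "\<Sigma> \<turnstile> \<phi>" and "{\<phi>} \<turnstile> \<psi>" and "common_vocabulary (\<Sigma> \<union> {\<phi>, \<psi>})"
  shows "\<Sigma> \<turnstile> \<psi>"
proof (rule cut)
  show "\<Sigma> \<union> {\<phi>} \<turnstile> \<psi>"
    using assms(3) by (intro weakening[OF assms(2)]) (auto simp: insert_commute)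
qed fact

text \<open>Two cuts lift the introduction rule from the set of its two conjuncts to any
  \<open>\<Sigma>\<close>. A single vocabulary \<open>\<tau>\<close> for all formulas settles every
  side condition at once.\<close>

lemma derives_And:
  assumes "vocabulary \<tau>" and "\<forall>\<chi> \<in> \<Sigma>. wff \<tau> \<chi>" and "wff \<tau> \<phi>" and "wff \<tau> \<psi>"
    and "\<Sigma> \<turnstile> \<phi>" and "\<Sigma> \<turnstile> \<psi>"
  shows "\<Sigma> \<turnstile> And \<phi> \<psi>"
proof (rule cut[OF assms(5)], rule cut)
  note cv = common_vocabularyI[OF assms(1)]
  show "\<Sigma> \<union> {\<phi>} \<turnstile> \<psi>"
    by (rule weakening[OF assms(6)]) (use assms(2-4) in \<open>auto intro!: cv\<close>)
  have "{\<phi>, \<psi>} \<turnstile> And \<phi> \<psi>"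
    by (rule conj_introduction) (use assms(3,4) in \<open>auto intro!: cv\<close>)
  then show "\<Sigma> \<union> {\<phi>} \<union> {\<psi>} \<turnstile> And \<phi> \<psi>"
    by (rule weakening) (use assms(2-4) in \<open>auto intro!: cv\<close>)
qed

lemma wff_Conj:
  assumes "\<forall>\<phi> \<in> set \<phi>s. wff \<tau> \<phi>"
  shows "wff \<tau> (Conj \<phi>s)"
  using assms by (induction \<phi>s rule: Conj.induct) auto

lemma derives_Conj:
  assumes "vocabulary \<tau>" and "\<forall>\<chi> \<in> \<Sigma>. wff \<tau> \<chi>" and "\<forall>\<phi> \<in> set \<phi>s. wff \<tau> \<phi>"
    and "\<forall>\<phi> \<in> set \<phi>s. \<Sigma> \<turnstile> \<phi>"
  shows "\<Sigma> \<turnstile> Conj \<phi>s"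
  using assms(3,4)
proof (induction \<phi>s rule: Conj.induct)
  case 1
  show ?case
    by (simp, rule weakening[OF indep_reflexivity])
      (use assms(2) in \<open>auto intro!: common_vocabularyI[OF assms(1)]\<close>)
next
  case 3
  then show ?case
    by (auto intro!: derives_And[OF assms(1,2)] wff_Conj)
qed simp

text \<open>Since \<open>Conj\<close> nests to the right, the second elimination is repeated down to
  the first occurrence of \<open>\<phi>\<close>. There the first elimination extracts it, unless it
  is the last conjunct and nothing is left to split.\<close>

lemma Conj_derives:
  assumes "vocabulary \<tau>" and "\<forall>\<phi> \<in> set \<phi>s. wff \<tau> \<phi>" and "\<phi> \<in> set \<phi>s"
  shows "{Conj \<phi>s} \<turnstile> \<phi>"
  using assms(2,3)
proof (induction \<phi>s rule: Conj.induct)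
  case 1
  then show ?case by simp
next
  case (2 \<psi>)
  then show ?case
    by (auto intro!: assumption common_vocabularyI[OF assms(1)])
next
  case (3 \<psi> \<chi> \<phi>s)
  note cv = common_vocabularyI[OF assms(1)]
  have wff: "wff \<tau> \<psi>" "wff \<tau> (Conj (\<chi> # \<phi>s))" "wff \<tau> \<phi>"
    using 3(2,3) wff_Conj[of "\<chi> # \<phi>s" \<tau>] by auto
  show ?case
  proof (cases "\<phi> = \<psi>")
    case True
    then show ?thesis
      using wff by (auto intro!: conj_elimination1 cv)
  next
    case False
    have "{And \<psi> (Conj (\<chi> # \<phi>s))} \<turnstile> Conj (\<chi> # \<phi>s)"
      using wff by (auto intro!: conj_elimination2 cv)
    moreover have "{Conj (\<chi> # \<phi>s)} \<turnstile> \<phi>"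
      using 3 False by auto
    ultimately have "{And \<psi> (Conj (\<chi> # \<phi>s))} \<turnstile> \<phi>"
      by (rule derives_trans) (use wff in \<open>auto intro!: cv\<close>)
    then show ?thesis by simp
  qed
qed

text \<open>All sorts and no relation symbols suffice for atoms. Three of them are what
  \<open>derives_trans\<close> asks for: the assumption, the intermediate formula and the
  conclusion.\<close>

lemma common_vocabulary_Indep:
  "common_vocabulary {ys \<bottom>\<^bsub>xs\<^esub> zs, ys' \<bottom>\<^bsub>xs'\<^esub> zs', ys'' \<bottom>\<^bsub>xs''\<^esub> zs''}"
  by (rule common_vocabularyI[of "\<lparr>sorts = UNIV, rel_sorts = Map.empty\<rparr>"])
    (auto simp: vocabulary_def)

text \<open>Permutation moves the surplus variables to the end of the right tuple, where
  Decomposition drops them.\<close>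

lemma Indep_derives_mset_subset_right:
  assumes "mset zs' \<subseteq># mset zs"
  shows "{ys \<bottom>\<^bsub>xs\<^esub> zs} \<turnstile> ys \<bottom>\<^bsub>xs\<^esub> zs'"
proof -
  obtain ws where ws: "mset ws = mset zs - mset zs'"
    using ex_mset by blast
  have "{ys \<bottom>\<^bsub>xs\<^esub> zs} \<turnstile> ys \<bottom>\<^bsub>xs\<^esub> zs' @ ws"
    using assms ws by (intro indep_permutation) auto
  then show ?thesis
    by (rule derives_trans)
      (use semigraphoid_decomposition common_vocabulary_Indep in \<open>auto simp: insert_commute\<close>)
qed

text \<open>A dependence atom carries \<open>ys\<close> on both sides: shrink the right one, swap by
  Symmetry, then shrink the other.\<close>

lemma Dep_derives_mset_subset:
  assumes "mset ys' \<subseteq># mset ys"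
  shows "{Dep xs ys} \<turnstile> Dep xs ys'"
proof -
  have "{Dep xs ys} \<turnstile> ys' \<bottom>\<^bsub>xs\<^esub> ys"
    using Indep_derives_mset_subset_right[OF assms] indep_symmetry
    by (rule derives_trans) (use common_vocabulary_Indep in auto)
  then show ?thesis
    using Indep_derives_mset_subset_right[OF assms]
    by (rule derives_trans) (use common_vocabulary_Indep in auto)
qed

lemma mset_nths_Compl: "mset (nths xs I) + mset (nths xs (- I)) = mset xs"
proof (induction xs arbitrary: I)
  case (Cons x xs)
  \<comment> \<open>Dropping the head shifts positions down by one, and this shift commutes with
    complement, so the induction hypothesis applies to the shifted set.\<close>
  have "{j. Suc j \<notin> I} = - {j. Suc j \<in> I}" by auto
  with Cons[of "{j. Suc j \<in> I}"] show ?case by (auto simp: nths_Cons)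
qed simp

lemma nths_singleton:
  assumes "i < length xs"
  shows "nths xs {i} = [xs ! i]"
  using assms
proof (induction xs arbitrary: i)
  case (Cons x xs)
  then show ?case
    by (cases i) (auto simp: nths_Cons)
qed simp

theorem lemma3p15:
  fixes xs ys zs :: "var list" and n :: nat
  assumes "length xs = n" and "length ys = n"
  shows "{And (Conj (map (\<lambda>I. nths xs (- I) \<bottom>\<^bsub>nths xs I @ zs\<^esub> nths ys I)
                        (map set (subseqs [0..<n]))))
              (Dep (xs @ zs) ys)}
         \<turnstile> (Conj (map (\<lambda>i. Dep (xs ! i # zs) [ys ! i]) [0..<n]) :: 'r formula)"
proof -
  define \<tau> :: "'r vocabulary" where "\<tau> = \<lparr>sorts = UNIV, rel_sorts = Map.empty\<rparr>"
  define A :: "'r formula list" where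
    "A = map (\<lambda>I. nths xs (- I) \<bottom>\<^bsub>nths xs I @ zs\<^esub> nths ys I) (map set (subseqs [0..<n]))"
  let ?\<Sigma> = "{And (Conj A) (Dep (xs @ zs) ys)}"
  have \<tau>: "vocabulary \<tau>"
    by (simp add: \<tau>_def vocabulary_def)
  have [simp]: "sorts \<tau> = UNIV"
    by (simp add: \<tau>_def)
  have A: "\<forall>\<phi> \<in> set A. wff \<tau> \<phi>"
    by (auto simp: A_def)
  then have [simp]: "wff \<tau> (Conj A)"
    by (rule wff_Conj)
  have trans: "?\<Sigma> \<turnstile> \<psi>" if "?\<Sigma> \<turnstile> \<phi>" "{\<phi>} \<turnstile> \<psi>" "wff \<tau> \<phi>" "wff \<tau> \<psi>" for \<phi> \<psi>
    using that(1,2) by (rule derives_trans) (use that in \<open>auto intro!: common_vocabularyI[OF \<tau>]\<close>)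
  have "?\<Sigma> \<turnstile> Dep (xs ! i # zs) [ys ! i]" if "i < n" for i
  proof -
    let ?u = "nths xs (- {i})" and ?v = "xs ! i # zs" and ?y = "[ys ! i]"
    have nths: "nths xs {i} = [xs ! i]" "nths ys {i} = ?y"
      using assms that by (simp_all add: nths_singleton)
    have "{i} \<in> set ` set (subseqs [0..<n])"
      using that by (auto simp: subseqs_powset)
    then have "(?u \<bottom>\<^bsub>nths xs {i} @ zs\<^esub> nths ys {i}) \<in> set A"
      unfolding A_def set_map by (intro imageI)
    then have "(?u \<bottom>\<^bsub>?v\<^esub> ?y) \<in> set A"
      by (simp add: nths)
    moreover have "?\<Sigma> \<turnstile> Conj A"
      by (rule conj_elimination1) (auto intro!: common_vocabularyI[OF \<tau>])
    ultimately have indep: "?\<Sigma> \<turnstile> ?u \<bottom>\<^bsub>?v\<^esub> ?y"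
      using Conj_derives[OF \<tau> A] by (auto intro: trans)
    have "?\<Sigma> \<turnstile> Dep (xs @ zs) ys"
      by (rule conj_elimination2) (auto intro!: common_vocabularyI[OF \<tau>])
    moreover have "{Dep (xs @ zs) ys} \<turnstile> (Dep (xs @ zs) ?y :: 'r formula)"
      using assms that by (intro Dep_derives_mset_subset) simp
    ultimately have "?\<Sigma> \<turnstile> Dep (xs @ zs) ?y"
      by (rule trans) auto
    \<comment> \<open>Bringing \<open>xs ! i\<close> to the front and the other entries of
      \<open>xs\<close> to the end gives the parameter the shape that First Transitivity
      requires.\<close>
    moreover have "{Dep (xs @ zs) ?y} \<turnstile> (Dep (?v @ ?u) ?y :: 'r formula)"
      using mset_nths_Compl[of xs "{i}"] by (intro dep_permutation) (auto simp: nths)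
    ultimately have "?\<Sigma> \<turnstile> Dep (?v @ ?u) ?y"
      by (rule trans) auto
    with indep have "?\<Sigma> \<turnstile> And (?u \<bottom>\<^bsub>?v\<^esub> ?y) (Dep (?v @ ?u) ?y)"
      by (intro derives_And[OF \<tau>]) auto
    \<comment> \<open>First Transitivity is used with \<open>?y\<close> in both outer roles, so that
      its conclusion is again a dependence atom, now over \<open>?v\<close> alone.\<close>
    then show ?thesis
      using indep_first_transitivity by (rule trans) auto
  qed
  then show ?thesis
    unfolding A_def[symmetric] by (intro derives_Conj[OF \<tau>]) auto
qed

end
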